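(* Let $d_0\ge 2$ be an integer, let $a=(2d_0-1)/d_0$, let $c>0$ be a real number, and let $b=p/2$ for $p=4d_0-3$. If \[ 2a+p-\frac{d_0-1}{d_0^2}<pc, \] then there always exists a convex generator $\Lambda$ such that $\Lambda\le_{P(a,1),E(bc,c)} e_{p,2}^{d_0}$.
   Context: A convex integral path is a path $\Lambda$ in the plane with endpoints $(0,y(\Lambda))$ and $(x(\Lambda),0)$, where $x(\Lambda),y(\Lambda)\ge 0$ are integers, which is the graph of a piecewise linear concave function $f:[0,x(\Lambda)]\to[0,y(\Lambda)]$ with $f'(0)\le 0$, possibly together with a vertical line segment at the right, and all of whose vertices (endpoints and points of slope change) are lattice points; its edges are the segments between consecutive vertices. A convex generator is a convex integral path each of whose edges is labeled "$e$" or "$h$", with horizontal and vertical edges labeled only "$e$". For relatively prime nonnegative integers $r,s$ and a positive integer $m$: $e_{r,s}^m$ denotes an edge with displacement vector $(mr,-ms)$ labeled "$e$"; $h_{r,s}$ denotes an edge with displacement $(r,-s)$ labeled "$h$"; and $e_{r,s}^{m-1}h_{r,s}$ ($m>1$) denotes an edge with displacement $(mr,-ms)$ labeled "$h$". A convex generator is identified with the commutative formal product of these symbols over its edges. $m(\Lambda)$ is the total exponent of all factors in the formal product (one less than the number of lattice points on $\Lambda$); $L(\Lambda)$ is the number of lattice points in the region enclosed by $\Lambda$ and the axes, boundary included; $h(\Lambda)$ is the number of edges labeled "$h$"; the ECH index is $I(\Lambda)=2(L(\Lambda)-1)-h(\Lambda)$. Symplectic actions: for the polydisk $P(a,1)$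 (the toric domain over the rectangle $[0,a]\times[0,1]$), $A_{P(a,1)}(\Lambda)=x(\Lambda)+a\,y(\Lambda)$; for the ellipsoid $E(bc,c)$ (the toric domain over the triangle with vertices $(0,0),(bc,0),(0,c)$), $A_{E(bc,c)}(\Lambda)=\max\{cx+bcy:(x,y)\in\Lambda\}$. For convex generators $\Lambda,\Lambda'$ with all edges of $\Lambda'$ labeled "$e$", one writes $\Lambda\le_{P(a,1),E(bc,c)}\Lambda'$ if: (i) $I(\Lambda)=I(\Lambda')$; (ii) $A_{P(a,1)}(\Lambda)\le A_{E(bc,c)}(\Lambda')$; (iii) $x(\Lambda)+y(\Lambda)-\frac{h(\Lambda)}{2}\ge x(\Lambda')+y(\Lambda')+m(\Lambda')-1$. *)

theory Defs
  imports "HOL-Analysis.Analysis" "HOL-Library.Multiset"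
begin

section \<open>Convex integral paths\<close>

definition piecewise_linear_on :: "real \<Rightarrow> real \<Rightarrow> (real \<Rightarrow> real) \<Rightarrow> bool" where
  "piecewise_linear_on a b f \<longleftrightarrow>
     (\<exists>T. finite T \<and>
       (\<forall>u v. a \<le> u \<and> u < v \<and> v \<le> b \<and> {u<..<v} \<inter> T = {} \<longrightarrow>
          (\<exists>\<mu> \<kappa>. \<forall>t\<in>{u..v}. f t = \<mu> * t + \<kappa>)))"

definition lattice :: "(real \<times> real) set" where
  "lattice = \<int> \<times> \<int>"

text \<open>
  A path is a set of points of the plane. Its vertices (the endpoints and the points where the slope
  changes) are the points of the path that are not interior to a line segment contained in the path.
\<close>

definition vertices :: "(real \<times> real) set \<Rightarrow> (real \<times> real) set" where
  "vertices P = {v \<in> P. \<not> (\<exists>u w. closed_segment u w \<subseteq> P \<and> v \<in> open_segment u w)}"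

text \<open>
  An edge is recorded as the pair of its end vertices, the upper left one first. On a concave path a
  segment joining two vertices that are not consecutive leaves the path, so the pairs below are exactly
  the pairs of consecutive vertices.
\<close>

definition edges :: "(real \<times> real) set \<Rightarrow> ((real \<times> real) \<times> (real \<times> real)) set" where
  "edges P = {(v, w). v \<in> vertices P \<and> w \<in> vertices P \<and> v \<noteq> w \<and>
                      fst v \<le> fst w \<and> snd w \<le> snd v \<and> closed_segment v w \<subseteq> P}"

text \<open>
  The set \<open>P\<close> is a convex integral path from \<open>(0, Y)\<close> to \<open>(X, 0)\<close>. The segment
  \<open>{X} \<times> {0..f X}\<close> is the optional vertical one; it is the single point \<open>(X, 0)\<close> if
  \<open>f X = 0\<close>. For \<open>X = 0\<close> there is no slope at \<open>0\<close> to constrain.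
\<close>

definition convex_integral_path :: "(real \<times> real) set \<Rightarrow> nat \<Rightarrow> nat \<Rightarrow> bool" where
  "convex_integral_path P X Y \<longleftrightarrow>
     (\<exists>f. piecewise_linear_on 0 (real X) f \<and>
          concave_on {0..real X} f \<and>
          f ` {0..real X} \<subseteq> {0..real Y} \<and>
          f 0 = real Y \<and>
          (0 < X \<longrightarrow> (\<exists>D\<le>0. (f has_real_derivative D) (at 0 within {0..real X}))) \<and>
          P = (\<lambda>t. (t, f t)) ` {0..real X} \<union> {real X} \<times> {0..f (real X)}) \<and>
     vertices P \<subseteq> lattice"

section \<open>Convex generators\<close>

text \<open>
  The endpoints are \<open>(0, yend)\<close> and \<open>(xend, 0)\<close>. The labelling is given by the set of edges
  labelled ``h''; all other edges are labelled ``e''.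
\<close>

record generator =
  gpath :: "(real \<times> real) set"
  xend :: nat
  yend :: nat
  hedges :: "((real \<times> real) \<times> (real \<times> real)) set"

definition convex_generator :: "generator \<Rightarrow> bool" where
  "convex_generator \<Lambda> \<longleftrightarrow>
     convex_integral_path (gpath \<Lambda>) (xend \<Lambda>) (yend \<Lambda>) \<and>
     hedges \<Lambda> \<subseteq> edges (gpath \<Lambda>) \<and>
     (\<forall>(v, w) \<in> hedges \<Lambda>. fst v \<noteq> fst w \<and> snd v \<noteq> snd w)"

text \<open>
  The commutative formal product is a multiset of factors: an edge with displacement
  \<open>(m * r, - m * s)\<close>, where \<open>r\<close> and \<open>s\<close> are coprime, contributes \<open>m\<close> factors.
\<close>

datatype factor = Efac nat nat | Hfac nat nat

definition edge_factors :: "bool \<Rightarrow> (real \<times> real) \<times> (real \<times> real) \<Rightarrow> factor multiset" where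
  "edge_factors is_h = (\<lambda>(v, w).
     let q = nat \<lfloor>fst w - fst v\<rfloor>;
         t = nat \<lfloor>snd v - snd w\<rfloor>;
         m = gcd q t;
         r = q div m;
         s = t div m
     in if is_h then add_mset (Hfac r s) (replicate_mset (m - 1) (Efac r s))
        else replicate_mset m (Efac r s))"

definition formal_product :: "generator \<Rightarrow> factor multiset" where
  "formal_product \<Lambda> = (\<Sum>E\<in>edges (gpath \<Lambda>). edge_factors (E \<in> hedges \<Lambda>) E)"

definition e_power :: "nat \<Rightarrow> nat \<Rightarrow> nat \<Rightarrow> generator" where
  "e_power r s m =
     \<lparr>gpath = closed_segment (0, real (m * s)) (real (m * r), 0),
      xend = m * r, yend = m * s, hedges = {}\<rparr>"

lemma vertices_segment: "vertices (closed_segment p q) = {p, q}"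
proof -
  have "closed_segment u w \<subseteq> closed_segment p q \<longleftrightarrow>
          u \<in> closed_segment p q \<and> w \<in> closed_segment p q" for u w
    using closed_segment_subset[of u "closed_segment p q" w]
      ends_in_segment[of u w] by auto
  then have "vertices (closed_segment p q) = {x. x extreme_point_of closed_segment p q}"
    unfolding vertices_def extreme_point_of_def by blast
  then show ?thesis
    by (auto simp: extreme_point_of_segment)
qed

lemma edges_e_power:
  assumes "coprime r s" "m > 0"
  shows "edges (gpath (e_power r s m)) = {((0, real (m * s)), (real (m * r), 0))}"
proof -
  define v w where "v = (0 :: real, real (m * s))" and "w = (real (m * r), 0 :: real)"
  have "r \<noteq> 0 \<or> s \<noteq> 0"
    using assms(1) by auto
  then have "v \<noteq> w" and *: "\<not> (fst w \<le> fst v \<and> snd v \<le> snd w)"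
    using assms(2) by (auto simp: v_def w_def mult_le_0_iff)
  have le: "fst v \<le> fst w" "snd w \<le> snd v"
    by (simp_all add: v_def w_def)
  have path: "gpath (e_power r s m) = closed_segment v w"
    by (simp add: e_power_def v_def w_def)
  have "edges (closed_segment v w) = {(v, w)}"
    unfolding edges_def vertices_segment using \<open>v \<noteq> w\<close> * le by auto
  then show ?thesis
    by (simp add: path v_def w_def)
qed

lemma formal_product_e_power:
  assumes "coprime r s" "m > 0"
  shows "formal_product (e_power r s m) = replicate_mset m (Efac r s)"
proof -
  have hed: "hedges (e_power r s m) = {}"
    by (simp add: e_power_def)
  have q: "nat \<lfloor>real (m * r) - 0\<rfloor> = m * r" and t: "nat \<lfloor>real (m * s) - 0\<rfloor> = m * s"
    by (simp_all only: diff_zero floor_of_nat nat_int)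
  have g: "gcd (m * r) (m * s) = m"
    using assms(1) by (simp add: gcd_mult_distrib_nat[symmetric])
  show ?thesis
    unfolding formal_product_def edges_e_power[OF assms] hed
    using assms(2) by (simp add: edge_factors_def Let_def q t g del: of_nat_mult)
qed

definition m_total :: "generator \<Rightarrow> nat" where
  "m_total \<Lambda> = size (formal_product \<Lambda>)"

definition L_count :: "generator \<Rightarrow> nat" where
  "L_count \<Lambda> = card ({(u, v). 0 \<le> v \<and> (\<exists>w. (u, w) \<in> gpath \<Lambda> \<and> v \<le> w)} \<inter> lattice)"

definition h_count :: "generator \<Rightarrow> nat" where
  "h_count \<Lambda> = card (hedges \<Lambda>)"

definition ECH_index :: "generator \<Rightarrow> int" where
  "ECH_index \<Lambda> = 2 * (int (L_count \<Lambda>) - 1) - int (h_count \<Lambda>)"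

section \<open>Actions and the relation between convex generators\<close>

text \<open>
  The polydisk is \<open>P(a, 1)\<close> and the ellipsoid is \<open>E(A, B)\<close>. The path is compact, so the supremum
  in the ellipsoid action is a maximum.
\<close>

definition action_polydisk :: "real \<Rightarrow> generator \<Rightarrow> real" where
  "action_polydisk a \<Lambda> = real (xend \<Lambda>) + a * real (yend \<Lambda>)"

definition action_ellipsoid :: "real \<Rightarrow> real \<Rightarrow> generator \<Rightarrow> real" where
  "action_ellipsoid A B \<Lambda> = (SUP (x, y) \<in> gpath \<Lambda>. B * x + A * y)"

definition gen_le :: "real \<Rightarrow> real \<Rightarrow> real \<Rightarrow> generator \<Rightarrow> generator \<Rightarrow> bool" where
  "gen_le a b c \<Lambda> \<Lambda>' \<longleftrightarrow>
     convex_generator \<Lambda> \<and> convex_generator \<Lambda>' \<and> hedges \<Lambda>' = {} \<and>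
     ECH_index \<Lambda> = ECH_index \<Lambda>' \<and>
     action_polydisk a \<Lambda> \<le> action_ellipsoid (b * c) c \<Lambda>' \<and>
     real (xend \<Lambda>) + real (yend \<Lambda>) - real (h_count \<Lambda>) / 2
       \<ge> real (xend \<Lambda>') + real (yend \<Lambda>') + real (m_total \<Lambda>') - 1"

end

theory Submission imports Defs begin

text \<open>
  The witness is the path \<open>(0, d - 1), (4d\<^sup>2 - d - 1, d - 1), (4d\<^sup>2 - d, 0)\<close> with all edges
  labelled ``e'', where \<open>d = d0\<close>: cutting the upper right corner off the rectangle of width
  \<open>4d\<^sup>2 - d\<close> and height \<open>d - 1\<close> removes \<open>d - 1\<close> lattice points, which leaves
  \<open>4d\<^sup>3 - d\<^sup>2 + 1\<close>, the number of lattice points under \<open>e\<^bsub>p,2\<^esub>\<^sup>d\<close>. Condition (iii) is then an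
  equality, and the polydisk action is \<open>d\<close> times the left-hand side of the assumed inequality.
\<close>

section \<open>Paths as graphs, their vertices, and the lattice points below them\<close>

definition graph_path :: "(real \<Rightarrow> real) \<Rightarrow> nat \<Rightarrow> (real \<times> real) set" where
  "graph_path f X = (\<lambda>t. (t, f t)) ` {0..real X} \<union> {real X} \<times> {0..f (real X)}"

lemma graph_path_zero_end:
  assumes "f (real X) = 0"
  shows "graph_path f X = (\<lambda>t. (t, f t)) ` {0..real X}"
  using assms by (auto simp: graph_path_def)

text \<open>Both sides are the translate by \<open>(0, \<kappa>)\<close> of the image of a real
  interval under the linear map \<open>\<lambda>t. (t, \<mu> * t)\<close>. This links the functional
  description of paths with segments, whose vertices are easy to control.\<close>

lemma closed_segment_graph:
  fixes \<mu> \<kappa> u v :: real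
  assumes "u \<le> v"
  shows "closed_segment (u, \<mu> * u + \<kappa>) (v, \<mu> * v + \<kappa>) = (\<lambda>t. (t, \<mu> * t + \<kappa>)) ` {u..v}"
proof -
  have lin: "linear (\<lambda>t. (t, \<mu> * t))"
    by (intro linearI) (auto simp: algebra_simps)
  have "closed_segment ((0, \<kappa>) + (u, \<mu> * u)) ((0, \<kappa>) + (v, \<mu> * v)) =
        (+) (0, \<kappa>) ` (\<lambda>t. (t, \<mu> * t)) ` closed_segment u v"
    by (simp only: closed_segment_translation closed_segment_linear_image[OF lin])
  then show ?thesis
    using assms by (simp add: closed_segment_eq_real_ivl image_image add.commute)
qed

text \<open>A point of a segment other than its ends lies in the open segment, so it cannot be a
  vertex. Equality may fail: \<open>q\<close> drops out when it lies strictly between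
  \<open>p\<close> and \<open>r\<close>. The inclusion suffices to make all vertices lattice
  points.\<close>

lemma vertices_two_segments: "vertices (closed_segment p q \<union> closed_segment q r) \<subseteq> {p, q, r}"
  unfolding vertices_def open_segment_def by blast

text \<open>Count by columns: above \<open>u = i\<close> the lattice heights are 0 up to the floor
  of \<open>f i\<close>. The vertical segment at the right end adds no point to the last column.
  Nonnegativity matters because \<open>nat\<close> would turn an empty column into one
  point.\<close>

lemma L_count_graph_path:
  assumes path: "gpath \<Lambda> = graph_path f X" and nonneg: "\<And>i. i \<le> X \<Longrightarrow> 0 \<le> f (real i)"
  shows "L_count \<Lambda> = (\<Sum>i\<le>X. Suc (nat \<lfloor>f (real i)\<rfloor>))"
proof -
  let ?S = "SIGMA i:{..X}. {..nat \<lfloor>f (real i)\<rfloor>}"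
  let ?g = "\<lambda>(i, j). (real i, real j)"
  have "{(u, v). 0 \<le> v \<and> (\<exists>w. (u, w) \<in> gpath \<Lambda> \<and> v \<le> w)} \<inter> lattice = ?g ` ?S"
  proof (intro equalityI subsetI)
    fix z assume "z \<in> {(u, v). 0 \<le> v \<and> (\<exists>w. (u, w) \<in> gpath \<Lambda> \<and> v \<le> w)} \<inter> lattice"
    then obtain u v where z: "z = (u, v)" and v0: "0 \<le> v" and u: "0 \<le> u" "u \<le> real X"
      and vf: "v \<le> f u" and int: "u \<in> \<int>" "v \<in> \<int>"
      by (auto simp: path graph_path_def lattice_def)
    obtain i where i: "u = real i"
      using u int by (metis Ints_cases nat_0_le of_int_0_le_iff of_int_of_nat_eq)
    obtain j where j: "v = real j"
      using v0 int by (metis Ints_cases nat_0_le of_int_0_le_iff of_int_of_nat_eq)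
    have "(i, j) \<in> ?S"
      using u vf unfolding i j by (auto simp: le_nat_floor)
    then show "z \<in> ?g ` ?S"
      unfolding z i j by force
  next
    fix z assume "z \<in> ?g ` ?S"
    then obtain i j where z: "z = (real i, real j)" and i: "i \<le> X" and j: "j \<le> nat \<lfloor>f (real i)\<rfloor>"
      by auto
    have "real j \<le> f (real i)"
      using j nonneg[OF i] by linarith
    then show "z \<in> {(u, v). 0 \<le> v \<and> (\<exists>w. (u, w) \<in> gpath \<Lambda> \<and> v \<le> w)} \<inter> lattice"
      using i by (auto simp: z path graph_path_def lattice_def intro!: exI[of _ "f (real i)"])
  qed
  moreover have "inj_on ?g ?S"
    by (auto simp: inj_on_def)
  ultimately show ?thesis
    by (simp add: L_count_def card_image)
qed

section \<open>The rectangle with a cut corner\<close>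

lemma affine_concave_on: "convex S \<Longrightarrow> concave_on S (\<lambda>t. \<mu> * t + \<kappa> :: real)"
  by (simp add: concave_on_iff algebra_simps flip: distrib_right)

lemma concave_on_min:
  fixes f g :: "'a::real_vector \<Rightarrow> real"
  assumes "concave_on S f" "concave_on S g"
  shows "concave_on S (\<lambda>x. min (f x) (g x))"
  unfolding concave_on_iff
proof (intro conjI ballI allI impI)
  show "convex S"
    using assms(1) by (rule concave_on_imp_convex)
next
  fix x y and u v :: real
  assume xy: "x \<in> S" "y \<in> S" and uv: "0 \<le> u" "0 \<le> v" "u + v = 1"
  have "u * min (f x) (g x) + v * min (f y) (g y) \<le> u * f x + v * f y"
       "u * min (f x) (g x) + v * min (f y) (g y) \<le> u * g x + v * g y"
    using uv by (auto intro!: add_mono mult_left_mono)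
  moreover have "u * f x + v * f y \<le> f (u *\<^sub>R x + v *\<^sub>R y)"
      "u * g x + v * g y \<le> g (u *\<^sub>R x + v *\<^sub>R y)"
    using assms xy uv by (auto simp: concave_on_iff)
  ultimately show "u * min (f x) (g x) + v * min (f y) (g y) \<le>
      min (f (u *\<^sub>R x + v *\<^sub>R y)) (g (u *\<^sub>R x + v *\<^sub>R y))"
    by linarith
qed

text \<open>As a minimum of two affine functions the height is visibly concave. The two agree at
  \<open>N\<close>, and the second vanishes at \<open>Suc N\<close>, so the optional vertical
  segment shrinks to a point.\<close>

definition corner_cut :: "nat \<Rightarrow> nat \<Rightarrow> generator" where
  "corner_cut N Y =
     \<lparr>gpath = graph_path (\<lambda>t. min (real Y) (real Y * (real (Suc N) - t))) (Suc N),
      xend = Suc N, yend = Y, hedges = {}\<rparr>"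

lemma convex_generator_corner_cut:
  assumes "0 < N"
  shows "convex_generator (corner_cut N Y)"
proof -
  define f where "f = (\<lambda>t. min (real Y) (real Y * (real (Suc N) - t)))"
  have left: "f t = real Y" if "t \<le> real N" for t
    using that mult_left_mono[of 1 "real (Suc N) - t" "real Y"] by (simp add: f_def)
  have right: "f t = - real Y * t + real Y * real (Suc N)" if "real N \<le> t" for t
    using that mult_left_mono[of "real (Suc N) - t" 1 "real Y"]
    by (simp add: f_def algebra_simps)
  have pl: "piecewise_linear_on 0 (real (Suc N)) f"
    unfolding piecewise_linear_on_def
  proof (intro exI[of _ "{real N}"] conjI allI impI)
    fix u v assume "0 \<le> u \<and> u < v \<and> v \<le> real (Suc N) \<and> {u<..<v} \<inter> {real N} = {}"
    then consider "v \<le> real N" | "real N \<le> u"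
      by force
    then show "\<exists>\<mu> \<kappa>. \<forall>t\<in>{u..v}. f t = \<mu> * t + \<kappa>"
    proof cases
      case 1
      then have "\<forall>t\<in>{u..v}. f t = 0 * t + real Y"
        by (simp add: left)
      then show ?thesis by blast
    next
      case 2
      then have "\<forall>t\<in>{u..v}. f t = - real Y * t + real Y * real (Suc N)"
        by (intro ballI right) simp
      then show ?thesis by blast
    qed
  qed simp
  have conc: "concave_on {0..real (Suc N)} f"
    using concave_on_min[OF affine_concave_on[of _ 0 "real Y"]
        affine_concave_on[of _ "- real Y" "real Y * real (Suc N)"]]
    by (simp add: f_def algebra_simps)
  have range: "f ` {0..real (Suc N)} \<subseteq> {0..real Y}"
    by (auto simp: f_def)
  \<comment> \<open>Within distance \<open>real N\<close> of 0 the function is constant;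
    \<open>0 < N\<close> makes this radius positive.\<close>
  have deriv: "(f has_real_derivative 0) (at 0 within {0..real (Suc N)})"
    by (rule has_field_derivative_transform_within[OF DERIV_const[of "real Y"], of "real N"])
       (use assms in \<open>auto simp: left dist_real_def\<close>)
  \<comment> \<open>Splitting at the breakpoint exhibits the path as two segments, so that
    \<open>vertices_two_segments\<close> bounds its vertices.\<close>
  have "{0..real (Suc N)} = {0..real N} \<union> {real N..real (Suc N)}"
    by auto
  then have "graph_path f (Suc N) =
      (\<lambda>t. (t, f t)) ` {0..real N} \<union> (\<lambda>t. (t, f t)) ` {real N..real (Suc N)}"
    by (subst graph_path_zero_end) (simp_all add: f_def image_Un)
  also have "(\<lambda>t. (t, f t)) ` {0..real N} = (\<lambda>t. (t, 0 * t + real Y)) ` {0..real N}"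
    by (intro image_cong) (auto simp: left)
  also have "\<dots> = closed_segment (0, real Y) (real N, real Y)"
    by (subst closed_segment_graph[symmetric]) simp_all
  also have "(\<lambda>t. (t, f t)) ` {real N..real (Suc N)} =
      (\<lambda>t. (t, - real Y * t + real Y * real (Suc N))) ` {real N..real (Suc N)}"
    by (intro image_cong refl) (simp only: right atLeastAtMost_iff)
  also have "\<dots> = closed_segment (real N, real Y) (real (Suc N), 0)"
    by (subst closed_segment_graph[symmetric]) (simp_all add: algebra_simps)
  finally have "vertices (graph_path f (Suc N)) \<subseteq> {(0, real Y), (real N, real Y), (real (Suc N), 0)}"
    by (simp only: vertices_two_segments)
  also have "\<dots> \<subseteq> lattice"
    by (auto simp: lattice_def simp del: of_nat_Suc)
  finally have "convex_integral_path (graph_path f (Suc N)) (Suc N) Y"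
    unfolding convex_integral_path_def graph_path_def
    by (intro conjI exI[of _ f]) (use pl conc range deriv left[of 0] in auto)
  then show ?thesis
    by (simp add: convex_generator_def corner_cut_def f_def)
qed

text \<open>Columns 0 to \<open>N\<close> are full, with \<open>Suc Y\<close> points each; the last
  column holds only its point on the axis.\<close>

lemma L_count_corner_cut: "L_count (corner_cut N Y) = Suc N * Suc Y + 1"
proof -
  define f where "f = (\<lambda>t. min (real Y) (real Y * (real (Suc N) - t)))"
  have val: "f (real i) = (if i = Suc N then 0 else real Y)" if "i \<le> Suc N" for i
    using that mult_left_mono[of 1 "real (Suc N) - real i" "real Y"] by (auto simp: f_def)
  have "L_count (corner_cut N Y) = (\<Sum>i\<le>Suc N. Suc (nat \<lfloor>f (real i)\<rfloor>))"
    by (rule L_count_graph_path)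
      (simp_all only: corner_cut_def generator.simps val f_def[symmetric], simp)
  also have "\<dots> = (\<Sum>i\<le>N. Suc Y) + 1"
    by (simp add: val)
  finally show ?thesis by simp
qed

section \<open>The generator with a single edge: lattice count and action\<close>

lemma gpath_e_power:
  assumes "0 < r" "0 < m"
  shows "gpath (e_power r s m) = graph_path (\<lambda>t. - (real s / real r) * t + real (m * s)) (m * r)"
proof -
  have "gpath (e_power r s m) = closed_segment (0, - (real s / real r) * 0 + real (m * s))
      (real (m * r), - (real s / real r) * real (m * r) + real (m * s))"
    using assms by (simp add: e_power_def)
  also have "\<dots> = (\<lambda>t. (t, - (real s / real r) * t + real (m * s))) ` {0..real (m * r)}"
    by (rule closed_segment_graph) simp
  finally show ?thesis
    using assms by (subst graph_path_zero_end) simp_all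
qed

lemma convex_generator_e_power:
  assumes "0 < r" "0 < m"
  shows "convex_generator (e_power r s m)"
proof -
  define f where "f = (\<lambda>t. - (real s / real r) * t + real (m * s))"
  have path: "gpath (e_power r s m) = graph_path f (m * r)"
    using gpath_e_power[OF assms] by (simp add: f_def)
  have "vertices (gpath (e_power r s m)) \<subseteq> lattice"
    by (auto simp: e_power_def vertices_segment lattice_def simp del: of_nat_mult)
  moreover have "piecewise_linear_on 0 (real (m * r)) f"
    unfolding piecewise_linear_on_def f_def by blast
  moreover have "concave_on {0..real (m * r)} f"
    unfolding f_def by (rule affine_concave_on) simp
  moreover have "f ` {0..real (m * r)} \<subseteq> {0..real (m * s)}"
  proof clarify
    fix t assume "t \<in> {0..real (m * r)}"
    then have "0 \<le> real s * t / real r" "real s * t / real r \<le> real s * real (m * r) / real r"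
      by (simp, intro divide_right_mono mult_left_mono) (auto simp del: of_nat_mult)
    then show "f t \<in> {0..real (m * s)}"
      using assms by (simp add: f_def mult.commute)
  qed
  moreover have "(f has_real_derivative - (real s / real r)) (at 0 within {0..real (m * r)})"
    unfolding f_def using assms by (auto intro!: derivative_eq_intros)
  moreover have "f 0 = real (m * s)" "- (real s / real r) \<le> 0"
    by (simp_all add: f_def)
  ultimately have "convex_integral_path (gpath (e_power r s m)) (m * r) (m * s)"
    unfolding convex_integral_path_def path graph_path_def by blast
  then show ?thesis
    by (simp add: convex_generator_def e_power_def)
qed

text \<open>Cut the range into \<open>d\<close> blocks of length \<open>p\<close>. Moving on by one
  block raises every quotient by 2, and in the first block the quotient is 0 up to \<open>k\<close>
  and 1 at the \<open>k\<close> remaining places.\<close>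

lemma sum_double_div_odd:
  fixes p k d :: nat
  assumes p: "p = 2 * k + 1"
  shows "(\<Sum>j<d * p. 2 * j div p) = d * ((d - 1) * p + k)"
proof (induction d)
  case (Suc d)
  have "(\<Sum>j<Suc d * p. 2 * j div p) =
      (\<Sum>j<d * p. 2 * j div p) + (\<Sum>j<p. 2 * (j + d * p) div p)"
    using sum.atLeastLessThan_concat[of 0 "d * p" "Suc d * p" "\<lambda>j. 2 * j div p"]
      sum.shift_bounds_nat_ivl[of "\<lambda>j. 2 * j div p" 0 "d * p" p]
    by (simp add: atLeast0LessThan)
  also have "(\<Sum>j<p. 2 * (j + d * p) div p) = (\<Sum>j<p. 2 * d + (if k < j then 1 else 0))"
  proof (intro sum.cong refl)
    fix j assume "j \<in> {..<p}"
    then have "2 * j div p = (if k < j then 1 else 0)"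
      by (auto simp: p intro: div_nat_eqI)
    moreover have "2 * (j + d * p) div p = (2 * j + 2 * d * p) div p"
      by (simp only: algebra_simps)
    moreover have "p \<noteq> 0"
      by (simp add: p)
    ultimately show "2 * (j + d * p) div p = 2 * d + (if k < j then 1 else 0)"
      by (simp only: div_mult_self1 not_False_eq_True)
  qed
  also have "\<dots> = p * (2 * d) + k"
  proof -
    have "{..<p} \<inter> {j. k < j} = {k<..2 * k}"
      by (auto simp: p)
    then show ?thesis
      by (simp add: sum.distrib sum.If_cases)
  qed
  finally show ?case
    \<comment> \<open>The case split removes the truncated \<open>d - 1\<close> of the induction
      hypothesis.\<close>
    using Suc by (cases d) (simp_all add: algebra_simps)
qed simp

text \<open>The count is doubled to keep the formula in the naturals once
  \<open>k = (p - 1) / 2\<close> is eliminated.\<close>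

lemma L_count_e_power_2:
  assumes "odd p" "0 < d"
  shows "2 * L_count (e_power p 2 d) = 2 * d\<^sup>2 * p + d * p + 3 * d + 2"
proof -
  obtain k where k: "p = 2 * k + 1"
    using assms by (elim oddE)
  have fl: "nat \<lfloor>- (real 2 / real p) * real i + real (d * 2)\<rfloor> = 2 * (d * p - i) div p"
    if "i \<le> d * p" for i
  proof -
    have "- (real 2 / real p) * real i + real (d * 2) = real (2 * (d * p - i)) / real p"
      using that k by (simp add: of_nat_diff field_simps)
    then show ?thesis
      by (simp only: floor_divide_of_nat_eq nat_int)
  qed
  have "L_count (e_power p 2 d) =
      (\<Sum>i\<le>d * p. Suc (nat \<lfloor>- (real 2 / real p) * real i + real (d * 2)\<rfloor>))"
  proof (rule L_count_graph_path)
    show "gpath (e_power p 2 d) = graph_path (\<lambda>t. - (real 2 / real p) * t + real (d * 2)) (d * p)"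
      using assms k by (intro gpath_e_power) auto
    show "0 \<le> - (real 2 / real p) * real i + real (d * 2)" if "i \<le> d * p" for i
    proof -
      have "real i \<le> real d * real p"
        using that by (simp flip: of_nat_mult)
      then show ?thesis
        using k by (simp add: field_simps)
    qed
  qed
  also have "\<dots> = (\<Sum>i\<le>d * p. Suc (2 * (d * p - i) div p))"
    by (intro sum.cong refl) (simp only: fl atMost_iff)
  \<comment> \<open>Reading the columns from right to left turns the descending heights into the sum
    of \<open>sum_double_div_odd\<close>, up to the last term \<open>j = d * p\<close>, which is
    split off below.\<close>
  also have "\<dots> = (\<Sum>j\<le>d * p. Suc (2 * j div p))"
    by (rule sum.reindex_bij_witness[of _ "\<lambda>j. d * p - j" "\<lambda>j. d * p - j"]) auto
  also have "\<dots> = d * p + 1 + (\<Sum>j\<le>d * p. 2 * j div p)"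
    by (simp only: sum.distrib Suc_eq_plus1) simp
  also have "(\<Sum>j\<le>d * p. 2 * j div p) = (\<Sum>j<d * p. 2 * j div p) + 2 * d"
  proof -
    have "2 * (d * p) div p = 2 * d"
      using k by (metis Suc_eq_plus1 mult.assoc nat.distinct(1) nonzero_mult_div_cancel_right)
    then show ?thesis
      by (simp flip: lessThan_Suc_atMost)
  qed
  also have "(\<Sum>j<d * p. 2 * j div p) = d * ((d - 1) * p + k)"
    using k by (rule sum_double_div_odd)
  finally show ?thesis
    using k assms by (cases d) (simp_all add: algebra_simps power2_eq_square)
qed

text \<open>The edge has slope \<open>- 2 / p\<close> and is thus a level line of the functional
  being maximised, so the supremum is that of a constant.\<close>

lemma action_ellipsoid_e_power_2:
  assumes "0 < p" "0 < d"
  shows "action_ellipsoid (real p / 2 * c) c (e_power p 2 d) = real d * real p * c"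
proof -
  have path: "gpath (e_power p 2 d) =
      (\<lambda>t. (t, - (real 2 / real p) * t + real (d * 2))) ` {0..real (d * p)}"
    by (subst gpath_e_power[OF assms], subst graph_path_zero_end) (use assms in simp_all)
  have "(\<lambda>(x, y). c * x + real p / 2 * c * y) ` gpath (e_power p 2 d) =
      (\<lambda>t. real d * real p * c) ` {0..real (d * p)}"
    unfolding path image_image by (intro image_cong) (use assms in \<open>simp_all add: field_simps\<close>)
  then show ?thesis
    by (simp add: action_ellipsoid_def)
qed

section \<open>The three conditions for the witness\<close>

theorem proposition3p5:
  fixes d0 p :: nat and a b c :: real
  assumes "d0 \<ge> 2"
    and "a = (2 * real d0 - 1) / real d0"
    and "c > 0"
    and "p = 4 * d0 - 3"
    and "b = real p / 2"
    and "2 * a + real p - (real d0 - 1) / (real d0)^2 < real p * c"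
  shows "\<exists>\<Lambda>. convex_generator \<Lambda> \<and> gen_le a b c \<Lambda> (e_power p 2 d0)"
proof (intro exI conjI)
  define N where "N = 4 * d0\<^sup>2 - d0 - 1"
  define \<Lambda> where "\<Lambda> = corner_cut N (d0 - 1)"
  \<comment> \<open>This bound makes the truncated subtractions in \<open>N\<close> exact.\<close>
  have "2 * d0 \<le> d0\<^sup>2"
    using assms(1) by (simp add: power2_eq_square)
  then have "0 < N" and rN: "real (Suc N) = 4 * (real d0)\<^sup>2 - real d0"
    using assms(1) unfolding N_def by (simp_all add: of_nat_diff)
  have p: "real p = 4 * real d0 - 3" "odd p" "0 < p"
    using assms(1,4) by (simp_all add: of_nat_diff)
  show gen: "convex_generator \<Lambda>"
    unfolding \<Lambda>_def by (rule convex_generator_corner_cut) fact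
  \<comment> \<open>Neither generator has an edge labelled h, so equality of the ECH indices reduces
    to equality of the lattice counts.\<close>
  have "real (2 * L_count (e_power p 2 d0)) = real (2 * d0\<^sup>2 * p + d0 * p + 3 * d0 + 2)"
    using assms(1) L_count_e_power_2[OF p(2), of d0] by simp
  also have "\<dots> = 2 * (real (Suc N) * real d0 + 1)"
    unfolding rN by (simp add: p(1) algebra_simps power2_eq_square)
  also have "\<dots> = real (2 * L_count \<Lambda>)"
    using assms(1) by (simp add: \<Lambda>_def L_count_corner_cut del: mult_Suc)
  finally have L: "L_count \<Lambda> = L_count (e_power p 2 d0)"
    by simp
  have act: "action_polydisk a \<Lambda> \<le> action_ellipsoid (b * c) c (e_power p 2 d0)"
  proof -
    have "action_polydisk a \<Lambda> = real d0 * (2 * a + real p - (real d0 - 1) / (real d0)^2)"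
      using assms(1) by (simp add: \<Lambda>_def action_polydisk_def corner_cut_def rN assms(2) p(1)
          of_nat_diff field_simps power2_eq_square del: of_nat_Suc)
    also have "\<dots> \<le> real d0 * (real p * c)"
      using assms(6) by (intro mult_left_mono) auto
    finally show ?thesis
      using action_ellipsoid_e_power_2[OF p(3), of d0 c] assms(1) by (simp add: assms(5) mult.assoc)
  qed
  \<comment> \<open>Since \<open>p\<close> is odd, it is coprime to 2 and the edge contributes
    exactly \<open>d0\<close> factors. Both sides of condition (iii) then equal
    \<open>4 * d0^2 - 1\<close>.\<close>
  have "m_total (e_power p 2 d0) = d0"
    using formal_product_e_power[of p 2 d0] p(2) assms(1) by (simp add: m_total_def)
  then show "gen_le a b c \<Lambda> (e_power p 2 d0)"
    unfolding gen_le_def using gen act L convex_generator_e_power[OF p(3), of d0 2] assms(1)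
    by (simp add: \<Lambda>_def corner_cut_def e_power_def ECH_index_def h_count_def rN p(1)
        of_nat_diff algebra_simps power2_eq_square del: of_nat_Suc)
qed

end
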